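(* Let $\mathcal{L} \subseteq \mathbb{S}^n$ be a linear subspace and $C, Y \in \mathbb{S}^n$. Let $\mathcal{S}_{opt}$ be the intersection of all admissible subspaces of $\mathbb{S}^n$. The map $P_{\mathcal{S}_{opt}} : \mathbb{S}^n\to\mathbb{S}^n$ is the (unique) minimum-rank orthogonal projection satisfying the Constraint Set Invariance and Unitality Conditions for $(C,Y,\mathcal{L})$.
   Context: $\mathbb{S}^n$ is the space of real symmetric $n\times n$ matrices with the trace inner product $X\cdot Y := \mathrm{Tr}(XY)$ and Jordan product $X\circ Y := \frac12(XY+YX)$; $\mathbb{S}^n_+$ is the positive semidefinite cone; $P_{\mathcal{S}}$ denotes orthogonal projection onto a subspace $\mathcal{S}$ (so its rank is $\dim\mathcal{S}$). Constraint Set Invariance Conditions: $P_{\mathcal{S}}$ satisfies them if (a) $P_{\mathcal{S}}(\mathbb{S}^n_+)\subseteq \mathbb{S}^n_+$; (b) $P_{\mathcal{S}}(Y+\mathcal{L})\subseteq Y+\mathcal{L}$; (c) $P_{\mathcal{S}}(C+\mathcal{L}^\perp)\subseteq C+\mathcal{L}^\perp$. Unitality Condition: there exists $E\in\mathcal{S}$ with $X\circ E=X$ for all $X\in\mathcal{S}$. A subspace $\mathcal{S}$ is admissible if $P_{\mathcal{S}}$ satisfies both sets of conditions. *)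

theory Defs
  imports "HOL-Analysis.Analysis"
begin

definition sym_mats :: "(real^'n^'n) set"
  where "sym_mats = {X. transpose X = X}"

definition tr_inner :: "real^'n^'n \<Rightarrow> real^'n^'n \<Rightarrow> real"
  where "tr_inner X Y = trace (X ** Y)"

definition jordan :: "real^'n^'n \<Rightarrow> real^'n^'n \<Rightarrow> real^'n^'n"
  where "jordan X Y = (1/2) *\<^sub>R (X ** Y + Y ** X)"

definition psd_cone :: "(real^'n^'n) set"
  where "psd_cone = {X \<in> sym_mats. \<forall>v. 0 \<le> v \<bullet> (X *v v)}"

definition sym_subspace :: "(real^'n^'n) set \<Rightarrow> bool"
  where "sym_subspace S \<longleftrightarrow> subspace S \<and> S \<subseteq> sym_mats"

text \<open>The complement is taken inside the space of symmetric matrices.\<close>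

definition orth_compl :: "(real^'n^'n) set \<Rightarrow> (real^'n^'n) set"
  where "orth_compl S = {Z \<in> sym_mats. \<forall>W\<in>S. tr_inner Z W = 0}"

text \<open>A map on the space of symmetric matrices is represented by a function that is
  \<^const>\<open>undefined\<close> outside \<^const>\<open>sym_mats\<close>, so that equality of HOL functions is equality of
  such maps.\<close>

definition orth_proj :: "(real^'n^'n) set \<Rightarrow> real^'n^'n \<Rightarrow> real^'n^'n"
  where "orth_proj S = (\<lambda>X\<in>sym_mats. THE Z. Z \<in> S \<and> X - Z \<in> orth_compl S)"

definition map_rank :: "(real^'n^'n \<Rightarrow> real^'n^'n) \<Rightarrow> nat"
  where "map_rank P = dim (P ` sym_mats)"

definition constraint_set_invariance ::
    "real^'n^'n \<Rightarrow> real^'n^'n \<Rightarrow> (real^'n^'n) set \<Rightarrow> (real^'n^'n \<Rightarrow> real^'n^'n) \<Rightarrow> bool"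
  where "constraint_set_invariance C Y L P \<longleftrightarrow>
    P ` psd_cone \<subseteq> psd_cone \<and>
    P ` ((+) Y ` L) \<subseteq> (+) Y ` L \<and>
    P ` ((+) C ` orth_compl L) \<subseteq> (+) C ` orth_compl L"

definition unital :: "(real^'n^'n) set \<Rightarrow> bool"
  where "unital S \<longleftrightarrow> (\<exists>E\<in>S. \<forall>X\<in>S. jordan X E = X)"

definition admissible ::
    "real^'n^'n \<Rightarrow> real^'n^'n \<Rightarrow> (real^'n^'n) set \<Rightarrow> (real^'n^'n) set \<Rightarrow> bool"
  where "admissible C Y L S \<longleftrightarrow>
    sym_subspace S \<and> constraint_set_invariance C Y L (orth_proj S) \<and> unital S"

definition S_opt :: "real^'n^'n \<Rightarrow> real^'n^'n \<Rightarrow> (real^'n^'n) set \<Rightarrow> (real^'n^'n) set"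
  where "S_opt C Y L = \<Inter> {S. admissible C Y L S}"

definition feasible_projection ::
    "real^'n^'n \<Rightarrow> real^'n^'n \<Rightarrow> (real^'n^'n) set \<Rightarrow> (real^'n^'n \<Rightarrow> real^'n^'n) \<Rightarrow> bool"
  where "feasible_projection C Y L P \<longleftrightarrow>
    (\<exists>S. sym_subspace S \<and> P = orth_proj S \<and> constraint_set_invariance C Y L P \<and> unital S)"

lemma subspace_sym_mats: "subspace (sym_mats :: (real^'n^'n) set)"
  by (auto simp: subspace_def sym_mats_def transpose_def vec_eq_iff)

lemma tr_inner_eq_inner:
  fixes X Y :: "real^'n^'n"
  assumes "X \<in> sym_mats"
  shows "tr_inner X Y = X \<bullet> Y"
proof -
  have s: "X $ i $ j = X $ j $ i" for i j
    using assms by (simp add: sym_mats_def transpose_def vec_eq_iff)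
  have "tr_inner X Y = (\<Sum>i\<in>UNIV. \<Sum>k\<in>UNIV. X $ i $ k * Y $ k $ i)"
    by (simp add: tr_inner_def trace_def matrix_matrix_mult_def)
  also have "\<dots> = (\<Sum>k\<in>UNIV. \<Sum>i\<in>UNIV. X $ i $ k * Y $ k $ i)"
    by (rule sum.swap)
  also have "\<dots> = X \<bullet> Y"
    by (simp add: inner_vec_def s)
  finally show ?thesis .
qed

text \<open>The definite description in \<^const>\<open>orth_proj\<close> is well defined.\<close>

lemma orth_proj_ex1:
  fixes S :: "(real^'n^'n) set"
  assumes S: "sym_subspace S" and X: "X \<in> sym_mats"
  shows "\<exists>!Z. Z \<in> S \<and> X - Z \<in> orth_compl S"
proof -
  have sub: "subspace S" and le: "S \<subseteq> sym_mats"
    using S by (auto simp: sym_subspace_def)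
  obtain y z where y: "y \<in> span S" and z: "\<And>w. w \<in> span S \<Longrightarrow> orthogonal z w" and e: "X = y + z"
    using orthogonal_subspace_decomp_exists by metis
  have yS: "y \<in> S" using y sub by (simp add: span_eq_iff[THEN iffD2])
  have "X - y \<in> sym_mats"
    using X yS le subspace_sym_mats by (blast intro: subspace_diff)
  moreover have "(X - y) \<bullet> w = 0" if "w \<in> S" for w
    using z[of w] that e by (simp add: span_base orthogonal_def)
  ultimately have ex: "y \<in> S \<and> X - y \<in> orth_compl S"
    using yS by (auto simp: orth_compl_def tr_inner_eq_inner)
  moreover have "u = v" if u: "u \<in> S \<and> X - u \<in> orth_compl S"
      and v: "v \<in> S \<and> X - v \<in> orth_compl S" for u v
  proof -
    have d: "u - v \<in> S" using u v sub by (blast intro: subspace_diff)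
    have "(X - u) \<bullet> (u - v) = 0" "(X - v) \<bullet> (u - v) = 0"
      using u v d by (auto simp: orth_compl_def tr_inner_eq_inner)
    then have "(u - v) \<bullet> (u - v) = 0"
      by (simp add: inner_diff_left)
    then show ?thesis by simp
  qed
  ultimately show ?thesis by blast
qed

text \<open>The family intersected in \<^const>\<open>S_opt\<close> is nonempty.\<close>

lemma admissible_sym_mats:
  fixes L :: "(real^'n^'n) set"
  assumes L: "sym_subspace L" and C: "C \<in> sym_mats" and Y: "Y \<in> sym_mats"
  shows "admissible C Y L sym_mats"
proof -
  have ss: "sym_subspace (sym_mats :: (real^'n^'n) set)"
    by (simp add: sym_subspace_def subspace_sym_mats)
  have id: "orth_proj sym_mats X = X" if X: "X \<in> sym_mats" for X :: "real^'n^'n"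
  proof -
    have "X \<in> sym_mats \<and> X - X \<in> orth_compl sym_mats"
      using X subspace_0[OF subspace_sym_mats]
      by (auto simp: orth_compl_def tr_inner_eq_inner)
    then have "(THE Z. Z \<in> sym_mats \<and> X - Z \<in> orth_compl sym_mats) = X"
      using orth_proj_ex1[OF ss X] by (blast intro: the1_equality)
    then show ?thesis using X by (simp add: orth_proj_def)
  qed
  have img: "orth_proj sym_mats ` A \<subseteq> A" if "A \<subseteq> sym_mats" for A :: "(real^'n^'n) set"
    using id that by (auto simp: subset_iff)
  have "psd_cone \<subseteq> (sym_mats :: (real^'n^'n) set)"
    by (auto simp: psd_cone_def)
  moreover have "(+) Y ` L \<subseteq> sym_mats"
    using L Y subspace_add[OF subspace_sym_mats] by (auto simp: sym_subspace_def)
  moreover have "(+) C ` orth_compl L \<subseteq> sym_mats"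
    using C subspace_add[OF subspace_sym_mats] by (auto simp: orth_compl_def)
  moreover have "unital (sym_mats :: (real^'n^'n) set)"
    unfolding unital_def
  proof (rule bexI[of _ "mat 1"])
    have "jordan X (mat 1) = X" for X :: "real^'n^'n"
      by (simp add: jordan_def flip: scaleR_2)
    then show "\<forall>X\<in>sym_mats. jordan X (mat 1 :: real^'n^'n) = X" by blast
  qed (simp add: sym_mats_def)
  ultimately show ?thesis
    unfolding admissible_def constraint_set_invariance_def using ss img by blast
qed

end

theory Submission
  imports Defs
begin

text \<open>
  Let \<open>S\<close> be an intersection of admissible subspaces. Every closed set invariant under all the
  admissible projections is invariant under the projection onto \<open>S\<close>: among the points of the set
  that have the same projection onto \<open>S\<close> as a given one, the point of least norm is fixed by every
  admissible projection, hence lies in \<open>S\<close>. This yields the invariance conditions for \<open>S\<close>. Applied to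
  the order interval \<open>0 \<le> Z \<le> I\<close> it also shows \<open>0 \<le> A \<le> I\<close> for the projection \<open>A\<close> of the identity
  onto \<open>S\<close>; since \<open>tr A = tr (A\<^sup>2)\<close>, the matrix \<open>A\<close> is idempotent, and it is an order unit of \<open>S\<close>,
  hence a Jordan unit. So \<open>S\<close> is admissible, and it is contained in every admissible subspace.
\<close>

section \<open>Positive semidefinite matrices\<close>

lemma sym_mats_add: "X \<in> sym_mats \<Longrightarrow> Y \<in> sym_mats \<Longrightarrow> X + Y \<in> sym_mats"
  and sym_mats_diff: "X \<in> sym_mats \<Longrightarrow> Y \<in> sym_mats \<Longrightarrow> X - Y \<in> sym_mats"
  and sym_mats_scaleR: "X \<in> sym_mats \<Longrightarrow> c *\<^sub>R X \<in> sym_mats"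
  by (simp_all add: subspace_sym_mats subspace_add subspace_diff subspace_scale)

lemma matrix_diff_ldistrib: "A ** (B - C) = A ** B - A ** C"
  and matrix_diff_rdistrib: "(B - C) ** A = B ** A - C ** A"
  for A B C :: "real^'n^'n"
  by (simp_all add: matrix_matrix_mult_def vec_eq_iff algebra_simps sum_subtractf)

lemma mat_1_sym_mats: "mat 1 \<in> sym_mats"
  by (simp add: sym_mats_def)

lemma sym_mats_inner_swap:
  assumes "X \<in> sym_mats"
  shows "(X *v v) \<bullet> w = v \<bullet> (X *v w)"
  using assms dot_lmul_matrix[of v X w] transpose_matrix_vector[of X v]
  by (simp add: sym_mats_def)

lemma psd_cone_sym: "X \<in> psd_cone \<Longrightarrow> X \<in> sym_mats"
  by (simp add: psd_cone_def)

lemma psd_cone_add: "X \<in> psd_cone \<Longrightarrow> Y \<in> psd_cone \<Longrightarrow> X + Y \<in> psd_cone"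
  by (auto simp: psd_cone_def sym_mats_add matrix_vector_mult_add_rdistrib inner_add_right)

lemma mat_1_psd_cone: "mat 1 \<in> psd_cone"
  by (simp add: psd_cone_def mat_1_sym_mats)

lemma congruence_psd_cone:
  fixes A :: "real^'n^'n"
  assumes "X \<in> psd_cone" "A \<in> sym_mats"
  shows "A ** X ** A \<in> psd_cone"
proof -
  have "transpose (A ** X ** A) = A ** X ** A"
    using assms by (simp add: psd_cone_def sym_mats_def matrix_transpose_mul matrix_mul_assoc)
  moreover have "v \<bullet> ((A ** X ** A) *v v) = (A *v v) \<bullet> (X *v (A *v v))" for v
    using sym_mats_inner_swap[OF assms(2)] by (simp add: matrix_vector_mul_assoc[symmetric])
  ultimately show ?thesis
    using assms(1) by (auto simp: psd_cone_def sym_mats_def)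
qed

text \<open>If \<open>w = T *v v\<close> were nonzero, the form of \<open>T\<close> at
  \<open>v + t w\<close> would have the linear term \<open>2 t (w \<bullet> w)\<close> and no
  constant term, hence be negative for small negative \<open>t\<close>.\<close>

lemma psd_cone_null_vector:
  fixes T :: "real^'n^'n"
  assumes T: "T \<in> psd_cone" and v: "v \<bullet> (T *v v) = 0"
  shows "T *v v = 0"
proof (rule ccontr)
  define w where "w = T *v v"
  define q where "q = w \<bullet> (T *v w)"
  assume "T *v v \<noteq> 0"
  then have w: "w \<bullet> w > 0" by (simp add: w_def)
  have q: "q \<ge> 0" using T by (auto simp: q_def psd_cone_def)
  have s: "v \<bullet> (T *v w) = w \<bullet> w"
    using sym_mats_inner_swap[OF psd_cone_sym[OF T], of v w] by (simp add: w_def)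
  have quadr: "0 \<le> 2 * t * (w \<bullet> w) + t^2 * q" for t
  proof -
    have "0 \<le> (v + t *\<^sub>R w) \<bullet> (T *v (v + t *\<^sub>R w))"
      using T by (auto simp: psd_cone_def)
    also have "\<dots> = v \<bullet> (T *v v) + t * (v \<bullet> (T *v w)) + t * (w \<bullet> (T *v v)) + t^2 * q"
      by (simp add: q_def power2_eq_square algebra_simps)
    finally show ?thesis using v s by (simp add: w_def)
  qed
  \<comment> \<open>The \<open>+ 1\<close> keeps the denominator positive when \<open>q = 0\<close>;
    with this choice the quadratic collapses to \<open>t * (w \<bullet> w) - t^2\<close>.\<close>
  define t where "t = - (w \<bullet> w) / (q + 1)"
  have t: "t < 0" using w q by (simp add: t_def divide_neg_pos)
  have "t * (q + 1) = - (w \<bullet> w)" using q by (simp add: t_def)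
  then have "2 * t * (w \<bullet> w) + t^2 * q = t * (w \<bullet> w) - t^2"
    by (simp add: power2_eq_square) algebra
  moreover have "t * (w \<bullet> w) < 0" using t w by (simp add: mult_neg_pos)
  ultimately show False using quadr[of t] zero_le_power2[of t] by linarith
qed

text \<open>Nonnegative diagonal entries with sum zero all vanish, so each basis vector is a null
  vector of the form and each column is zero.\<close>

lemma psd_cone_trace_0:
  fixes T :: "real^'n^'n"
  assumes T: "T \<in> psd_cone" and tr: "trace T = 0"
  shows "T = 0"
proof -
  have diag: "axis i 1 \<bullet> (T *v axis i 1) = T $ i $ i" for i
    by (simp add: inner_axis' matrix_vector_mul_component inner_axis)
  then have "T $ i $ i \<ge> 0" for i
    using T by (metis (no_types, lifting) mem_Collect_eq psd_cone_def)
  then have "T $ i $ i = 0" for i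
    using tr by (simp add: trace_def sum_nonneg_eq_0_iff)
  then have "T *v axis i 1 = 0" for i
    using psd_cone_null_vector[OF T] diag by metis
  then have "(T *v axis j 1) $ i = 0" for i j
    by simp
  then show ?thesis
    by (simp add: vec_eq_iff matrix_vector_mul_component inner_axis)
qed

lemma closed_psd_cone: "closed (psd_cone :: (real^'n^'n) set)"
proof -
  have "continuous_on UNIV (\<lambda>X :: real^'n^'n. v \<bullet> (X *v v))" for v
    by (intro linear_continuous_on linear_conv_bounded_linear[THEN iffD1] linearI)
      (simp_all add: matrix_vector_mult_add_rdistrib scaleR_matrix_vector_assoc[symmetric]
        inner_add_right)
  then have "closed {X :: real^'n^'n. \<forall>v. 0 \<le> v \<bullet> (X *v v)}"
    by (intro closed_Collect_all closed_Collect_le continuous_on_const)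
  then have "closed (sym_mats \<inter> {X :: real^'n^'n. \<forall>v. 0 \<le> v \<bullet> (X *v v)})"
    using closed_subspace[OF subspace_sym_mats] by (rule closed_Int[rotated])
  also have "sym_mats \<inter> {X :: real^'n^'n. \<forall>v. 0 \<le> v \<bullet> (X *v v)} = psd_cone"
    by (auto simp: psd_cone_def)
  finally show ?thesis .
qed

lemma trace_mult_sym_mats: "X \<in> sym_mats \<Longrightarrow> trace (X ** Y) = X \<bullet> Y"
  using tr_inner_eq_inner[of X Y] by (simp add: tr_inner_def)

lemma trace_eq_inner_mat_1:
  fixes X :: "real^'n^'n"
  shows "trace X = mat 1 \<bullet> X"
  using trace_mult_sym_mats[OF mat_1_sym_mats, of X] by simp

text \<open>\<open>A - A ** A\<close> is a sum of congruences of \<open>mat 1 - A\<close> and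
  \<open>A\<close>, so it is positive semidefinite without any diagonalization; its trace is
  zero.\<close>

lemma psd_cone_below_mat_1_idempotent:
  fixes A :: "real^'n^'n"
  assumes A: "A \<in> psd_cone" "mat 1 - A \<in> psd_cone" and tr: "trace (A ** A) = trace A"
  shows "A ** A = A"
proof -
  have "A - A ** A = A ** (mat 1 - A) ** A + (mat 1 - A) ** A ** (mat 1 - A)"
    by (simp add: matrix_diff_ldistrib matrix_diff_rdistrib matrix_mul_assoc)
  also have "\<dots> \<in> psd_cone"
    using A by (intro psd_cone_add congruence_psd_cone psd_cone_sym)
  finally have "A - A ** A \<in> psd_cone" .
  moreover have "trace (A - A ** A) = 0" using tr by (simp add: trace_sub)
  ultimately show ?thesis using psd_cone_trace_0 by fastforce
qed

lemma idempotent_psd_cone: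
  fixes E :: "real^'n^'n"
  assumes "E \<in> sym_mats" "E ** E = E"
  shows "E \<in> psd_cone"
  using congruence_psd_cone[OF mat_1_psd_cone assms(1)] assms(2) by simp

text \<open>By Cauchy-Schwarz the operator norm of \<open>X\<close> bounds its quadratic form: the
  identity is an order unit.\<close>

lemma sym_mats_order_bounded:
  fixes X :: "real^'n^'n"
  assumes X: "X \<in> sym_mats"
  obtains c where "c *\<^sub>R mat 1 + X \<in> psd_cone" "c *\<^sub>R mat 1 - X \<in> psd_cone"
proof -
  define c where "c = onorm ((*v) X)"
  have le: "\<bar>v \<bullet> (X *v v)\<bar> \<le> c * (v \<bullet> v)" for v
  proof -
    have "\<bar>v \<bullet> (X *v v)\<bar> \<le> norm v * norm (X *v v)" by (rule Cauchy_Schwarz_ineq2)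
    also have "\<dots> \<le> norm v * (c * norm v)"
      unfolding c_def by (intro mult_left_mono onorm matrix_vector_mul_bounded_linear norm_ge_zero)
    finally show ?thesis by (simp add: dot_square_norm power2_eq_square algebra_simps)
  qed
  have "0 \<le> c * (v \<bullet> v) + v \<bullet> (X *v v)" "0 \<le> c * (v \<bullet> v) - v \<bullet> (X *v v)" for v
    using le[of v] by linarith+
  then have "c *\<^sub>R mat 1 + X \<in> psd_cone" "c *\<^sub>R mat 1 - X \<in> psd_cone"
    using X by (auto simp: psd_cone_def mat_1_sym_mats sym_mats_add sym_mats_diff sym_mats_scaleR
        matrix_vector_mult_add_rdistrib matrix_vector_mult_diff_rdistrib
        scaleR_matrix_vector_assoc[symmetric] inner_add_right inner_diff_right)
  then show thesis by (rule that)
qed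

section \<open>Orthogonal projections\<close>

lemma sym_subspace_subspace: "sym_subspace S \<Longrightarrow> subspace S"
  by (simp add: sym_subspace_def)

lemma orth_proj_props:
  assumes "sym_subspace S" "X \<in> sym_mats"
  shows "orth_proj S X \<in> S" "X - orth_proj S X \<in> orth_compl S"
  using theI'[OF orth_proj_ex1[OF assms]] assms(2) by (simp_all add: orth_proj_def)

lemma orth_proj_sym_mats: "sym_subspace S \<Longrightarrow> X \<in> sym_mats \<Longrightarrow> orth_proj S X \<in> sym_mats"
  using orth_proj_props(1) by (auto simp: sym_subspace_def)

lemma orth_proj_inner:
  assumes "sym_subspace S" "X \<in> sym_mats" "W \<in> S"
  shows "orth_proj S X \<bullet> W = X \<bullet> W"
proof -
  have "X - orth_proj S X \<in> sym_mats" "tr_inner (X - orth_proj S X) W = 0"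
    using orth_proj_props(2)[OF assms(1,2)] assms(3) by (auto simp: orth_compl_def)
  then show ?thesis using tr_inner_eq_inner by (fastforce simp: inner_diff_left)
qed

text \<open>Testing inner products against \<open>S\<close> replaces the definite description;
  linearity of the projection follows from it.\<close>

lemma orth_proj_unique:
  assumes S: "sym_subspace S" and X: "X \<in> sym_mats" and Z: "Z \<in> S"
    and eq: "\<And>W. W \<in> S \<Longrightarrow> Z \<bullet> W = X \<bullet> W"
  shows "orth_proj S X = Z"
proof -
  have "X - Z \<in> sym_mats" using S X Z sym_mats_diff by (auto simp: sym_subspace_def)
  then have "X - Z \<in> orth_compl S"
    by (simp add: orth_compl_def tr_inner_eq_inner inner_diff_left eq)
  then show ?thesis using orth_proj_ex1[OF S X] orth_proj_props[OF S X] Z by blast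
qed

lemma orth_proj_id: "sym_subspace S \<Longrightarrow> X \<in> S \<Longrightarrow> orth_proj S X = X"
  by (rule orth_proj_unique) (auto simp: sym_subspace_def)

lemma orth_proj_diff:
  assumes S: "sym_subspace S" and X: "X \<in> sym_mats" and Y: "Y \<in> sym_mats"
  shows "orth_proj S (X - Y) = orth_proj S X - orth_proj S Y"
  using assms
  by (intro orth_proj_unique)
    (simp_all add: sym_mats_diff orth_proj_inner inner_diff_left orth_proj_props sym_subspace_subspace
      subspace_diff)

lemma orth_proj_add:
  assumes S: "sym_subspace S" and X: "X \<in> sym_mats" and Y: "Y \<in> sym_mats"
  shows "orth_proj S (X + Y) = orth_proj S X + orth_proj S Y"
  using assms
  by (intro orth_proj_unique)
    (simp_all add: sym_mats_add orth_proj_inner inner_add_left orth_proj_props sym_subspace_subspace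
      subspace_add)

lemma orth_proj_scaleR:
  assumes S: "sym_subspace S" and X: "X \<in> sym_mats"
  shows "orth_proj S (c *\<^sub>R X) = c *\<^sub>R orth_proj S X"
  using assms
  by (intro orth_proj_unique)
    (simp_all add: sym_mats_scaleR orth_proj_inner orth_proj_props sym_subspace_subspace
      subspace_scale)

lemma orth_proj_image: "sym_subspace S \<Longrightarrow> orth_proj S ` sym_mats = S"
  using orth_proj_props(1)[of S] orth_proj_id[of S, symmetric]
  by (auto simp: sym_subspace_def)

text \<open>Pythagoras: the squared distance from \<open>X\<close> to its projection is the
  difference of their squared norms.\<close>

lemma orth_proj_fixed_of_norm_le:
  assumes S: "sym_subspace S" and X: "X \<in> sym_mats" and le: "norm X \<le> norm (orth_proj S X)"
  shows "orth_proj S X = X"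
proof -
  define P where "P = orth_proj S X"
  have "P \<bullet> P = X \<bullet> P"
    using orth_proj_inner[OF S X orth_proj_props(1)[OF S X]] by (simp add: P_def)
  then have "(P - X) \<bullet> (P - X) = X \<bullet> X - P \<bullet> P"
    by (simp add: inner_diff_left inner_diff_right inner_commute)
  also have "\<dots> \<le> 0" using le by (simp add: norm_le P_def)
  finally have "P - X = 0" using inner_gt_zero_iff[of "P - X"] by linarith
  then show ?thesis by (simp add: P_def)
qed

section \<open>Projection onto an intersection of subspaces\<close>

lemma sym_subspace_Inter:
  assumes "F \<noteq> {}" "\<And>S. S \<in> F \<Longrightarrow> sym_subspace S"
  shows "sym_subspace (\<Inter>F)"
  using assms by (auto simp: sym_subspace_def intro!: subspace_Inter)

lemma orth_proj_Inter_invariant: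
  assumes F: "F \<noteq> {}" "\<And>S. S \<in> F \<Longrightarrow> sym_subspace S"
    and K: "closed K" "K \<subseteq> sym_mats"
    and inv: "\<And>S. S \<in> F \<Longrightarrow> orth_proj S ` K \<subseteq> K"
  shows "orth_proj (\<Inter>F) ` K \<subseteq> K"
proof
  fix Z assume "Z \<in> orth_proj (\<Inter>F) ` K"
  then obtain X where X: "X \<in> K" and Z: "Z = orth_proj (\<Inter>F) X" by blast
  have I: "sym_subspace (\<Inter>F)" using F by (rule sym_subspace_Inter)
  \<comment> \<open>The points of \<open>K\<close> with the same projection onto the intersection as
    \<open>X\<close>, cut out by linear equations so that closedness is immediate.\<close>
  define K' where "K' = K \<inter> (\<Inter>W\<in>\<Inter>F. {V. V \<bullet> W = X \<bullet> W})"
  have same: "orth_proj (\<Inter>F) V = Z" if "V \<in> K'" for V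
    unfolding Z using that K X orth_proj_props(1)[OF I] orth_proj_inner[OF I]
    by (intro orth_proj_unique[OF I]) (auto simp: K'_def)
  have "closed K'"
    unfolding K'_def using K(1)
    by (intro closed_Int closed_INT ballI closed_Collect_eq continuous_intros)
  moreover have "X \<in> K'" using X by (simp add: K'_def)
  ultimately obtain V where V: "V \<in> K'" and min: "\<And>U. U \<in> K' \<Longrightarrow> norm V \<le> norm U"
    using distance_attains_inf[of K' 0] by (auto simp: dist_norm)
  have Vs: "V \<in> sym_mats" using V K by (auto simp: K'_def)
  \<comment> \<open>Every \<open>W\<close> in the intersection lies in \<open>S\<close>, so
    projecting onto \<open>S\<close> keeps the pairings with \<open>W\<close>. The projection of
    \<open>V\<close> thus stays in \<open>K'\<close>, where \<open>V\<close> has least norm.\<close>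
  have fixed: "orth_proj S V = V" if S: "S \<in> F" for S
  proof (rule orth_proj_fixed_of_norm_le[OF F(2)[OF S] Vs], rule min)
    show "orth_proj S V \<in> K'"
      using V inv[OF S] orth_proj_inner[OF F(2)[OF S] Vs] S by (auto simp: K'_def)
  qed
  have "V \<in> \<Inter>F"
  proof
    fix S assume S: "S \<in> F"
    show "V \<in> S" using orth_proj_props(1)[OF F(2)[OF S] Vs] fixed[OF S] by simp
  qed
  then have "Z = V" using same[OF V] orth_proj_id[OF I] by simp
  then show "Z \<in> K" using V by (simp add: K'_def)
qed

section \<open>The unit of a positive projection\<close>

text \<open>The projection of the identity is the Jordan unit \<open>E\<close>, an idempotent. This
  turns unitality into an order inequality, a form that can pass to intersections.\<close>

lemma orth_proj_mat_1_of_unital: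
  fixes S :: "(real^'n^'n) set"
  assumes S: "sym_subspace S" and pos: "orth_proj S ` psd_cone \<subseteq> psd_cone" and u: "unital S"
  shows "mat 1 - orth_proj S (mat 1) \<in> psd_cone"
proof -
  obtain E where E: "E \<in> S" and unit: "\<And>X. X \<in> S \<Longrightarrow> jordan X E = X"
    using u by (auto simp: unital_def)
  have Es: "E \<in> sym_mats" using S E by (auto simp: sym_subspace_def)
  have EE: "E ** E = E"
    using unit[OF E] by (simp add: jordan_def flip: scaleR_2)
  have c: "mat 1 - E \<in> psd_cone"
    using Es EE
    by (intro idempotent_psd_cone sym_mats_diff mat_1_sym_mats)
      (simp_all add: matrix_diff_ldistrib matrix_diff_rdistrib)
  define T where "T = orth_proj S (mat 1 - E)"
  have T: "T \<in> psd_cone" "T \<in> S"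
    using c pos orth_proj_props(1)[OF S psd_cone_sym[OF c]] by (auto simp: T_def)
  have "trace T = trace (jordan T E)" by (simp add: unit T)
  also have "\<dots> = (trace (T ** E) + trace (E ** T)) / 2"
    by (simp add: jordan_def trace_eq_inner_mat_1 inner_add_right)
  also have "\<dots> = trace (E ** T)"
    by (simp add: trace_mul_sym[of T E])
  also have "\<dots> = (mat 1 - E) \<bullet> E"
    using orth_proj_inner[OF S psd_cone_sym[OF c] E]
    by (simp add: trace_mult_sym_mats Es T_def inner_commute)
  also have "\<dots> = trace E - trace (E ** E)"
    by (simp add: inner_diff_left trace_mult_sym_mats Es trace_eq_inner_mat_1[of E])
  finally have "T = 0" using T(1) EE by (simp add: psd_cone_trace_0)
  then have "orth_proj S (mat 1) = E"
    by (simp add: T_def orth_proj_diff[OF S mat_1_sym_mats Es] orth_proj_id[OF S E])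
  then show ?thesis using c by simp
qed

text \<open>The converse passage, from order to unit: projecting the bounds of \<open>X\<close> by
  multiples of the identity bounds it by multiples of the idempotent \<open>A\<close>, so
  \<open>X\<close> vanishes on the kernel of \<open>A\<close>.\<close>

lemma unital_of_orth_proj_mat_1:
  fixes S :: "(real^'n^'n) set"
  assumes S: "sym_subspace S" and pos: "orth_proj S ` psd_cone \<subseteq> psd_cone"
    and le: "mat 1 - orth_proj S (mat 1) \<in> psd_cone"
  shows "unital S"
proof -
  define A where "A = orth_proj S (mat 1)"
  have AS: "A \<in> S" using orth_proj_props(1)[OF S mat_1_sym_mats] by (simp add: A_def)
  have A: "A \<in> psd_cone" using pos mat_1_psd_cone by (auto simp: A_def)
  have As: "A \<in> sym_mats" using A by (rule psd_cone_sym)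
  \<comment> \<open>\<open>A \<bullet> A = mat 1 \<bullet> A\<close> because \<open>A\<close> is the
    projection of the identity and lies in \<open>S\<close>.\<close>
  have "trace (A ** A) = trace A"
    using orth_proj_inner[OF S mat_1_sym_mats AS]
    by (simp add: trace_mult_sym_mats[OF As] trace_eq_inner_mat_1[of A] flip: A_def)
  then have AA: "A ** A = A"
    using A le by (intro psd_cone_below_mat_1_idempotent) (simp_all add: A_def)
  have right: "X ** A = X" if X: "X \<in> S" for X
  proof -
    have Xs: "X \<in> sym_mats" using S X by (auto simp: sym_subspace_def)
    obtain c where c: "c *\<^sub>R mat 1 + X \<in> psd_cone" "c *\<^sub>R mat 1 - X \<in> psd_cone"
      using sym_mats_order_bounded[OF Xs] .
    have "orth_proj S (c *\<^sub>R mat 1 + X) = c *\<^sub>R A + X" "orth_proj S (c *\<^sub>R mat 1 - X) = c *\<^sub>R A - X"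
      using S X Xs
      by (simp_all add: orth_proj_add orth_proj_diff orth_proj_scaleR orth_proj_id
          mat_1_sym_mats sym_mats_scaleR A_def)
    then have c': "c *\<^sub>R A + X \<in> psd_cone" "c *\<^sub>R A - X \<in> psd_cone"
      using c pos by (metis image_subset_iff)+
    have "(X - X ** A) *v v = 0" for v
    proof -
      define w where "w = (mat 1 - A) *v v"
      have Aw: "A *v w = 0"
        by (simp add: w_def matrix_vector_mul_assoc matrix_diff_ldistrib AA)
      \<comment> \<open>As \<open>A\<close> kills \<open>w\<close>, these are the values of the
        forms of \<open>X\<close> and \<open>-X\<close> at \<open>w\<close>; both being nonnegative,
        they vanish.\<close>
      have "0 \<le> w \<bullet> ((c *\<^sub>R A + X) *v w)" "0 \<le> w \<bullet> ((c *\<^sub>R A - X) *v w)"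
        using c' by (auto simp: psd_cone_def)
      then have "w \<bullet> ((c *\<^sub>R A + X) *v w) = 0"
        by (simp add: matrix_vector_mult_add_rdistrib matrix_vector_mult_diff_rdistrib
            scaleR_matrix_vector_assoc[symmetric] Aw)
      then have "(c *\<^sub>R A + X) *v w = 0" by (rule psd_cone_null_vector[OF c'(1)])
      then have "X *v w = 0"
        by (simp add: matrix_vector_mult_add_rdistrib scaleR_matrix_vector_assoc[symmetric] Aw)
      then show ?thesis by (simp add: w_def matrix_vector_mul_assoc matrix_diff_ldistrib)
    qed
    then have "X - X ** A = 0" by (simp add: matrix_eq)
    then show ?thesis by simp
  qed
  have "jordan X A = X" if X: "X \<in> S" for X
  proof -
    have "transpose X = X" using S X by (auto simp: sym_subspace_def sym_mats_def)
    then have "A ** X = transpose (X ** A)"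
      using As by (simp add: matrix_transpose_mul sym_mats_def)
    then show ?thesis
      using right[OF X] \<open>transpose X = X\<close> by (simp add: jordan_def flip: scaleR_2)
  qed
  then show ?thesis using AS by (auto simp: unital_def)
qed

section \<open>Intersections of admissible subspaces\<close>

lemma subspace_orth_compl: "subspace (orth_compl S)"
  using subspace_sym_mats
  by (auto simp: subspace_def orth_compl_def tr_inner_eq_inner inner_add_left)

text \<open>The three invariance conditions concern closed sets and pass directly. Unitality is not
  of that kind, so it is traded for an inequality on the projected identity, obtained from one more
  invariant set.\<close>

lemma admissible_Inter:
  fixes L :: "(real^'n^'n) set"
  assumes L: "sym_subspace L" and C: "C \<in> sym_mats" and Y: "Y \<in> sym_mats"
    and F: "F \<noteq> {}" "\<And>S. S \<in> F \<Longrightarrow> admissible C Y L S"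
  shows "admissible C Y L (\<Inter>F)"
proof -
  have sub: "sym_subspace S" and pos: "orth_proj S ` psd_cone \<subseteq> psd_cone"
    and invY: "orth_proj S ` ((+) Y ` L) \<subseteq> (+) Y ` L"
    and invC: "orth_proj S ` ((+) C ` orth_compl L) \<subseteq> (+) C ` orth_compl L"
    and unital: "unital S" if "S \<in> F" for S
    using F(2)[OF that] by (auto simp: admissible_def constraint_set_invariance_def)
  note Inter_invariant = orth_proj_Inter_invariant[OF F(1) sub]
  have I: "sym_subspace (\<Inter>F)" using F(1) sub by (rule sym_subspace_Inter)
  have psd: "orth_proj (\<Inter>F) ` psd_cone \<subseteq> psd_cone"
    using pos by (intro Inter_invariant closed_psd_cone) (auto intro: psd_cone_sym)
  have "orth_proj (\<Inter>F) ` ((+) Y ` L) \<subseteq> (+) Y ` L"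
    using invY L Y sym_mats_add[OF Y]
    by (intro Inter_invariant closed_translation closed_subspace) (auto simp: sym_subspace_def)
  moreover have "orth_proj (\<Inter>F) ` ((+) C ` orth_compl L) \<subseteq> (+) C ` orth_compl L"
    using invC sym_mats_add[OF C]
    by (intro Inter_invariant closed_translation closed_subspace subspace_orth_compl)
      (auto simp: orth_compl_def)
  moreover have "unital (\<Inter>F)"
  proof (rule unital_of_orth_proj_mat_1[OF I psd])
    \<comment> \<open>Only the upper half of the order interval is needed here; the lower bound
      comes from \<open>psd\<close>.\<close>
    define K :: "(real^'n^'n) set" where "K = {Z \<in> sym_mats. mat 1 - Z \<in> psd_cone}"
    have "K = (-) (mat 1) ` psd_cone"
      by (force simp: K_def image_iff mat_1_sym_mats intro: sym_mats_diff psd_cone_sym)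
    also have "\<dots> = (+) (mat 1) ` (uminus ` psd_cone)"
      by (simp add: image_image)
    finally have "closed K"
      by (simp add: closed_translation closed_negations closed_psd_cone)
    moreover have "orth_proj S Z \<in> K" if S: "S \<in> F" and Z: "Z \<in> K" for S Z
    proof -
      have Zs: "Z \<in> sym_mats" using Z by (simp add: K_def)
      have "orth_proj S (mat 1 - Z) \<in> psd_cone" using pos[OF S] Z by (auto simp: K_def)
      \<comment> \<open>Splits \<open>mat 1 - orth_proj S Z\<close>: the first summand is positive
        semidefinite by unitality of \<open>S\<close>, the second by positivity of the
        projection.\<close>
      then have "(mat 1 - orth_proj S (mat 1)) + (orth_proj S (mat 1) - orth_proj S Z) \<in> psd_cone"
        using orth_proj_mat_1_of_unital[OF sub[OF S] pos[OF S] unital[OF S]]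
        by (intro psd_cone_add) (simp_all add: orth_proj_diff[OF sub[OF S] mat_1_sym_mats Zs])
      then show ?thesis using orth_proj_sym_mats[OF sub[OF S] Zs] by (simp add: K_def)
    qed
    ultimately have "orth_proj (\<Inter>F) ` K \<subseteq> K"
      by (intro Inter_invariant) (auto simp: K_def)
    moreover have "mat 1 \<in> K"
      using subspace_0[OF subspace_sym_mats] by (simp add: K_def mat_1_sym_mats psd_cone_def)
    ultimately have "orth_proj (\<Inter>F) (mat 1) \<in> K" by blast
    then show "mat 1 - orth_proj (\<Inter>F) (mat 1) \<in> psd_cone" by (simp add: K_def)
  qed
  ultimately show ?thesis
    using I psd by (simp add: admissible_def constraint_set_invariance_def)
qed

section \<open>Minimality of the rank and uniqueness\<close>

lemma feasible_projection_iff: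
  "feasible_projection C Y L P \<longleftrightarrow> (\<exists>S. admissible C Y L S \<and> P = orth_proj S)"
  by (auto simp: feasible_projection_def admissible_def)

lemma map_rank_orth_proj: "sym_subspace S \<Longrightarrow> map_rank (orth_proj S) = dim S"
  by (simp add: map_rank_def orth_proj_image)

theorem corollary3p1:
  fixes L :: "(real^'n^'n) set" and C Y :: "real^'n^'n"
  assumes "subspace L" and "L \<subseteq> sym_mats"
    and "C \<in> sym_mats" and "Y \<in> sym_mats"
  shows "is_arg_min map_rank (feasible_projection C Y L) (orth_proj (S_opt C Y L)) \<and>
    (\<forall>Q. is_arg_min map_rank (feasible_projection C Y L) Q \<longrightarrow> Q = orth_proj (S_opt C Y L))"
proof -
  let ?T = "S_opt C Y L"
  have L: "sym_subspace L" using assms by (simp add: sym_subspace_def)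
  \<comment> \<open>The whole space \<open>sym_mats\<close> is admissible, so the intersected family
    is nonempty.\<close>
  have T: "admissible C Y L ?T"
    unfolding S_opt_def
    using admissible_sym_mats[OF L assms(3,4)] by (intro admissible_Inter L assms) auto
  have le: "?T \<subseteq> S" if "admissible C Y L S" for S
    using that by (auto simp: S_opt_def)
  have rank: "map_rank (orth_proj S) = dim S" "subspace S" if "admissible C Y L S" for S
    using that map_rank_orth_proj by (auto simp: admissible_def sym_subspace_def)
  have min: "is_arg_min map_rank (feasible_projection C Y L) (orth_proj ?T)"
    using T dim_subset[OF le] by (auto simp: is_arg_min_linorder feasible_projection_iff rank(1))
  moreover have "Q = orth_proj ?T" if Q: "is_arg_min map_rank (feasible_projection C Y L) Q" for Q
  proof -
    obtain S where S: "admissible C Y L S" "Q = orth_proj S"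
      using Q by (auto simp: is_arg_min_def feasible_projection_iff)
    \<comment> \<open>A minimizer's subspace contains \<open>?T\<close>, so equal dimension forces
      equality.\<close>
    have "dim S \<le> dim ?T"
      using Q T by (auto simp: is_arg_min_linorder feasible_projection_iff S(2) rank(1)[OF S(1)] rank(1)[OF T])
    then have "?T = S"
      using rank[OF T] rank[OF S(1)] le[OF S(1)] by (intro subspace_dim_equal)
    then show ?thesis using S by simp
  qed
  ultimately show ?thesis by blast
qed

end
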